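(* Let $A=(A,\cdot,\circ)$ be a brace whose multiplicative group $(A,\circ)$ is isomorphic to $\mathbb{Z}^2$. Then $A$ is a bi-skew brace.
   Context: A skew brace (meaning skew left brace) is a set $A$ with two group structures $(A,\cdot)$ (the additive group) and $(A,\circ)$ (the multiplicative group) such that $a\circ(b\cdot c)=(a\circ b)\cdot a^{-1}\cdot(a\circ c)$ for all $a,b,c\in A$, where $a^{-1}$ is the inverse of $a$ in $(A,\cdot)$. A brace is a skew brace whose additive group $(A,\cdot)$ is abelian. A bi-skew brace is a skew brace $(A,\cdot,\circ)$ such that $(A,\circ,\cdot)$ is also a skew brace. *)

theory Defs
  imports "HOL-Algebra.Algebra"
begin

text \<open>
  A skew (left) brace is rendered by two group records on a common carrier: \<open>A\<close> is the
  additive group \<open>(A, \<cdot>)\<close> and \<open>M\<close> is the multiplicative group \<open>(A, \<circ>)\<close>.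
  The inverse in the compatibility law is the one of the additive group.
\<close>

definition skew_brace :: "'a monoid \<Rightarrow> 'a monoid \<Rightarrow> bool" where
  "skew_brace A M \<longleftrightarrow>
     group A \<and> group M \<and> carrier M = carrier A \<and>
     (\<forall>a\<in>carrier A. \<forall>b\<in>carrier A. \<forall>c\<in>carrier A.
        a \<otimes>\<^bsub>M\<^esub> (b \<otimes>\<^bsub>A\<^esub> c) = (a \<otimes>\<^bsub>M\<^esub> b) \<otimes>\<^bsub>A\<^esub> inv\<^bsub>A\<^esub> a \<otimes>\<^bsub>A\<^esub> (a \<otimes>\<^bsub>M\<^esub> c))"

definition brace :: "'a monoid \<Rightarrow> 'a monoid \<Rightarrow> bool" where
  "brace A M \<longleftrightarrow> skew_brace A M \<and> comm_group A"

definition bi_skew_brace :: "'a monoid \<Rightarrow> 'a monoid \<Rightarrow> bool" where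
  "bi_skew_brace A M \<longleftrightarrow> skew_brace A M \<and> skew_brace M A"

end

theory Submission
  imports Defs "HOL-Computational_Algebra.Polynomial"
begin

text \<open>
  Since both groups are commutative, the brace is a commutative radical ring \<open>R\<close>: in additive
  notation, \<open>a \<circ> b = a + b + a b\<close> for an associative bilinear product, and \<open>a \<mapsto> 1 + a\<close> identifies
  \<open>(A, \<circ>)\<close> with the group \<open>1 + R\<close> of units of the ring obtained by adjoining 1. The law with the
  two groups exchanged amounts to \<open>a b c = 0\<close> for all \<open>a\<close>, \<open>b\<close>, \<open>c\<close> (\<open>opposite_compat\<close>). So the
  task is to show \<open>R\<^sup>3 = 0\<close> when \<open>1 + R\<close> is isomorphic to \<open>\<int>\<^sup>2\<close>. Besides
  commutativity, the isomorphism enters through two facts: \<open>1 + R\<close> is torsion-free, and any three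
  of its elements are multiplicatively dependent.

  It suffices to treat one element \<open>r\<close> at a time: if \<open>R\<close> is additively torsion-free and all cubes
  vanish, polarization gives \<open>R\<^sup>3 = 0\<close> (\<open>star_square_zero\<close>, \<open>triple_product_zero\<close>). For a single
  \<open>r\<close>, everything happens in \<open>\<int>[X]\<close> and in the ideal of the polynomials without constant term
  that vanish at \<open>r\<close>. The units \<open>u(r)\<close>, for \<open>u\<close> with constant term 1, lie in \<open>1 + R\<close>, so any three
  such \<open>u\<close> give a polynomial relation for \<open>r\<close>. Well-chosen triples give three conclusions.

  Three pairwise comaximal monic polynomials give a relation that is nonzero modulo every
  prime \<open>p\<close>. If \<open>p r = 0\<close>, its lowest term shows that \<open>r\<close> is nilpotent, and then \<open>1 + R\<close> would have
  torsion unless \<open>r = 0\<close>. Hence \<open>R\<close> is torsion-free as an additive group (\<open>indeterminate_no_torsion\<close>).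

  If the lowest term of a relation is \<open>c r\<^sup>m\<close> with \<open>c \<noteq> 0\<close>, a multiple of \<open>r\<close> acts on \<open>r\<^sup>m R\<close> as the
  integer \<open>c\<close>. Unless \<open>r\<^sup>m = 0\<close>, this yields three elements of \<open>1 + R\<close> acting as pairwise coprime
  integers greater than 1, and these are independent. Hence \<open>r\<close> is nilpotent
  (\<open>indeterminate_nilpotent\<close>).

  If \<open>r\<close> had nilpotency index \<open>m \<ge> 4\<close>, the elements \<open>1 + r\<^sup>m\<^sup>-\<^sup>3\<close>, \<open>1 + r\<^sup>m\<^sup>-\<^sup>2\<close> and \<open>1 + r\<^sup>m\<^sup>-\<^sup>1\<close> would be
  independent. Hence \<open>r\<^sup>3 = 0\<close> (\<open>indeterminate_cubed\<close>).
\<close>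

section \<open>Comaximal elements and Sylvester sequences\<close>

definition comaximal :: "'b::comm_ring_1 \<Rightarrow> 'b \<Rightarrow> bool" where
  "comaximal a b \<longleftrightarrow> (\<exists>u v. u * a + v * b = 1)"

lemma comaximal_sym: "comaximal a b \<Longrightarrow> comaximal b a"
  unfolding comaximal_def by (metis add.commute)

lemma comaximal_1: "comaximal a 1"
  unfolding comaximal_def by (rule exI[of _ 0], rule exI[of _ 1]) simp

lemma comaximal_mult:
  assumes "comaximal a b" "comaximal a c"
  shows "comaximal a (b * c)"
proof -
  obtain u v u' v' where "u * a + v * b = 1" "u' * a + v' * c = 1"
    using assms unfolding comaximal_def by blast
  then have "(u * a + v * b) * (u' * a + v' * c) = 1" by simp
  then have "(u * a * u' + u * v' * c + v * b * u') * a + (v * v') * (b * c) = 1"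
    by (simp add: algebra_simps)
  then show ?thesis unfolding comaximal_def by blast
qed

lemma comaximal_power: "comaximal a b \<Longrightarrow> comaximal a (b ^ n)"
  by (induction n) (auto intro: comaximal_1 comaximal_mult)

lemma comaximal_prod: "(\<And>j. j \<in> J \<Longrightarrow> comaximal a (f j)) \<Longrightarrow> comaximal a (prod f J)"
  by (induction J rule: infinite_finite_induct) (auto intro: comaximal_1 comaximal_mult)

text \<open>
  Modulo \<open>d\<close>, the relation says that two products of powers agree, and \<open>s i\<close> occurs in exactly
  one of them. It is comaximal with the other one, hence modulo \<open>d\<close> with a multiple
  of itself, and so it is a unit there.
\<close>
lemma unit_mod_of_power_relation:
  fixes s :: "nat \<Rightarrow> 'b::comm_ring_1" and e :: "nat \<Rightarrow> int"
  assumes comax: "\<And>i j. i < k \<Longrightarrow> j < k \<Longrightarrow> i \<noteq> j \<Longrightarrow> comaximal (s i) (s j)"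
    and i: "i < k" "e i \<noteq> 0"
    and dvd: "d dvd (\<Prod>j<k. s j ^ nat (e j)) - (\<Prod>j<k. s j ^ nat (- e j))"
  shows "\<exists>w. d dvd s i * w - 1"
proof -
  have main: "\<exists>w. d dvd s i * w - 1"
    if "e i > 0" and "d dvd (\<Prod>j<k. s j ^ nat (e j)) - (\<Prod>j<k. s j ^ nat (- e j))" for e :: "nat \<Rightarrow> int"
  proof -
    let ?P = "\<Prod>j<k. s j ^ nat (e j)" and ?Q = "\<Prod>j<k. s j ^ nat (- e j)"
    have "s i dvd s i ^ nat (e i)" using that(1) by (simp add: dvd_power)
    also have "s i ^ nat (e i) dvd ?P" using i(1) by (intro dvd_prodI) auto
    finally obtain P' where P': "?P = s i * P'" by blast
    have "comaximal (s i) (s j ^ nat (- e j))" if "j < k" for j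
      using that \<open>e i > 0\<close> comax[OF i(1) that]
      by (cases "j = i") (auto intro: comaximal_1 comaximal_power)
    then have "comaximal (s i) ?Q" by (intro comaximal_prod) auto
    then obtain u v where uv: "u * s i + v * ?Q = 1" unfolding comaximal_def by blast
    have "d dvd v * (?P - ?Q)" using that(2) by simp
    also have "v * (?P - ?Q) = s i * (v * P' + u) - (u * s i + v * ?Q)"
      unfolding P' by (simp add: algebra_simps)
    finally show ?thesis unfolding uv by blast
  qed
  show ?thesis
  proof (cases "e i > 0")
    case True
    then show ?thesis using main dvd by blast
  next
    case False
    then show ?thesis using main[of "\<lambda>j. - e j"] i
        dvd[THEN dvd_minus_iff[THEN iffD2]] by simp
  qed
qed

text \<open>
  For \<open>x = 1\<close> over the integers this is Sylvester's sequence 2, 3, 7, 43, ... It serves as a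
  supply of pairwise comaximal elements, all congruent to 1 modulo \<open>x\<close>, that exists in every
  commutative ring and is preserved by ring homomorphisms.
\<close>
fun sylvester :: "'b::comm_ring_1 \<Rightarrow> nat \<Rightarrow> 'b" where
  "sylvester x n = 1 + x * (\<Prod>j<n. sylvester x j)"

declare sylvester.simps [simp del]

lemma comaximal_sylvester:
  assumes "i \<noteq> j"
  shows "comaximal (sylvester x i) (sylvester x j)"
proof -
  have *: "comaximal (sylvester x i) (sylvester x j)" if "i < j" for i j
  proof -
    have "sylvester x i dvd (\<Prod>l<j. sylvester x l)" using that by (intro dvd_prodI) auto
    then obtain w where "(\<Prod>l<j. sylvester x l) = sylvester x i * w" by blast
    then have "sylvester x j = 1 + x * (sylvester x i * w)"
      by (subst sylvester.simps) simp
    then have "(- x * w) * sylvester x i + 1 * sylvester x j = 1"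
      by (simp add: algebra_simps)
    then show ?thesis unfolding comaximal_def by blast
  qed
  show ?thesis using assms *[of i j] *[of j i] by (meson comaximal_sym nat_neq_iff)
qed

lemma sylvester_int_gt_1:
  fixes c :: int
  assumes "c > 0"
  shows "sylvester c n > 1"
proof (induction n rule: less_induct)
  case (less n)
  have "(\<Prod>j<n. sylvester c j) > 0" using less by (intro prod_pos) force
  then show ?case using assms by (subst sylvester.simps) simp
qed

lemma monic_1_plus:
  fixes f :: "int poly"
  assumes "lead_coeff f = 1"
  shows "lead_coeff (1 + [:0, 1:] * f) = 1 \<and> degree (1 + [:0, 1:] * f) > 0"
proof -
  have f: "f \<noteq> 0" using assms by auto
  then have "1 + [:0, 1:] * f = pCons 1 f" by (simp add: one_pCons)
  then show ?thesis using assms f by simp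
qed

lemma sylvester_indeterminate_monic:
  "lead_coeff (sylvester [:0, 1::int:] n) = 1 \<and> degree (sylvester [:0, 1::int:] n) > 0"
proof (induction n rule: less_induct)
  case (less n)
  have "lead_coeff (\<Prod>j<n. sylvester [:0, 1::int:] j) = (\<Prod>j<n. lead_coeff (sylvester [:0, 1::int:] j))"
    by (rule lead_coeff_prod)
  also have "\<dots> = 1" using less by simp
  finally show ?case by (subst (1 2 3) sylvester.simps) (rule monic_1_plus)
qed

lemma coeff_0_sylvester: "coeff x 0 = 0 \<Longrightarrow> coeff (sylvester x n) 0 = 1"
  by (subst sylvester.simps) (simp add: coeff_mult_0)

text \<open>
  A nonconstant monic polynomial stays nonconstant over \<open>\<int>/p\<close>, so it cannot become a unit there.
  Division with remainder by \<open>f\<close> makes this precise: if \<open>f h = 1 + p k\<close>, reducing \<open>k\<close> modulo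
  \<open>f\<close> leaves on the right a polynomial of degree less than \<open>degree f\<close>, which must then be \<open>0\<close>.
  For \<open>p = 0\<close> the lemma says that \<open>f\<close> is not a unit of \<open>\<int>[X]\<close>.
\<close>
lemma monic_not_unit_mod:
  fixes f :: "int poly"
  assumes monic: "lead_coeff f = 1" and deg: "degree f > 0" and p: "\<not> is_unit p"
  shows "\<not> of_int p dvd f * h - 1"
proof
  assume "of_int p dvd f * h - 1"
  then obtain k where k: "f * h - 1 = of_int p * k" by blast
  obtain q r where qr: "pseudo_divmod k f = (q, r)" by fastforce
  have "f \<noteq> 0" using deg by auto
  from pseudo_divmod[OF this qr] have kqr: "k = f * q + r" and r: "r = 0 \<or> degree r < degree f"
    using monic by simp_all
  have eq: "f * (h - of_int p * q) = 1 + of_int p * r"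
    using k unfolding kqr by (simp add: algebra_simps)
  have "degree (of_int p * r) < degree f"
    using r deg by (auto simp: of_int_poly intro: le_less_trans[OF degree_smult_le])
  then have "degree (1 + of_int p * r) < degree f" using deg by (intro degree_add_less) auto
  then have "h - of_int p * q = 0"
    using eq degree_mult_eq[OF \<open>f \<noteq> 0\<close>] by (metis not_add_less1)
  then have "1 + of_int p * r = 0" using eq by simp
  then have "coeff (1 + of_int p * r) 0 = 0" by simp
  then have "1 = p * (- coeff r 0)" by (simp add: of_int_poly)
  then show False using p by (metis dvd_triv_left)
qed

text \<open>
  The decomposition at the lowest coefficient that \<open>p\<close> does not divide. For \<open>p = 0\<close> this is
  the lowest nonzero coefficient.
\<close>
lemma first_nonmultiple_coeff:
  fixes D :: "int poly"
  assumes "\<not> of_int p dvd D"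
  shows "\<exists>m D1 D2. D = of_int p * D1 + [:0, 1:] ^ m * D2 \<and> \<not> p dvd coeff D2 0"
  using assms
proof (induction D)
  case 0
  then show ?case by simp
next
  case (pCons c D)
  show ?case
  proof (cases "p dvd c")
    case False
    then show ?thesis
      by (intro exI[of _ 0] exI[of _ 0] exI[of _ "pCons c D"]) simp
  next
    case True
    then obtain b where b: "c = p * b" by blast
    have "\<not> of_int p dvd D"
    proof
      assume "of_int p dvd D"
      then obtain k where "D = of_int p * k" by blast
      then have "pCons c D = of_int p * pCons b k" by (simp add: b of_int_poly)
      then show False using pCons.prems by (metis dvd_triv_left)
    qed
    then obtain m D1 D2 where D: "D = of_int p * D1 + [:0, 1:] ^ m * D2" "\<not> p dvd coeff D2 0"
      using pCons.IH by blast
    have "pCons c D = of_int p * pCons b D1 + [:0, 1:] ^ Suc m * D2"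
      by (simp add: D(1) b of_int_poly)
    then show ?thesis using D(2) by blast
  qed
qed

lemma power_1_plus:
  fixes s :: "'b::comm_ring_1"
  shows "\<exists>w. (1 + s) ^ n = 1 + of_nat n * s + s\<^sup>2 * w"
proof (induction n)
  case 0
  show ?case by (intro exI[of _ 0]) simp
next
  case (Suc n)
  then obtain w where w: "(1 + s) ^ n = 1 + of_nat n * s + s\<^sup>2 * w" by blast
  have "(1 + s) ^ Suc n = 1 + of_nat (Suc n) * s + s\<^sup>2 * (of_nat n + w + s * w)"
    by (simp add: w algebra_simps power2_eq_square)
  then show ?case by blast
qed

section \<open>Ideals of integer polynomials with a unit group of rank two\<close>

abbreviation \<tau> :: "int poly" where "\<tau> \<equiv> [:0, 1:]"

lemma pCons_0_cases: "coeff f 0 = c \<Longrightarrow> \<exists>q. f = pCons c q"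
  by (cases f) auto

text \<open>
  What the argument needs to know about the ideal of all \<open>f \<in> X \<int>[X]\<close> with \<open>f(r) = 0\<close>, where \<open>r\<close>
  is an element of a commutative radical ring \<open>R\<close> without unit. The condition \<open>cancel\<close> holds
  because \<open>1 + h(r)\<close> is invertible for \<open>h \<in> X \<int>[X]\<close>; \<open>root\<close> says that the adjoint group \<open>1 + R\<close> is
  torsion-free, and \<open>dependent\<close> that its rank is at most two: any three of its elements satisfy a
  nontrivial multiplicative relation, here with the negative exponents moved to the other side.
\<close>
locale vanishing_ideal =
  fixes N :: "int poly \<Rightarrow> bool"
  assumes add: "N f \<Longrightarrow> N g \<Longrightarrow> N (f + g)"
    and mult: "N f \<Longrightarrow> N (h * f)"
    and coeff_0: "N f \<Longrightarrow> coeff f 0 = 0"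
    and cancel: "coeff f 0 = 0 \<Longrightarrow> coeff u 0 = 1 \<Longrightarrow> N (f * u) \<Longrightarrow> N f"
    and root: "coeff u 0 = 1 \<Longrightarrow> n > 0 \<Longrightarrow> N (u ^ n - 1) \<Longrightarrow> N (u - 1)"
    and dependent: "(\<And>i. coeff (s i) 0 = 1) \<Longrightarrow>
      \<exists>e :: nat \<Rightarrow> int. (\<exists>i<3. e i \<noteq> 0) \<and>
        N ((\<Prod>i<3. s i ^ nat (e i)) - (\<Prod>i<3. s i ^ nat (- e i)))"
begin

lemma mult_right: "N f \<Longrightarrow> N (f * h)"
  using mult[of f h] by (simp add: mult.commute)

lemma zero: "N 0"
  using dependent[of "\<lambda>_. 1"] by simp

lemma minus: "N f \<Longrightarrow> N (- f)"
  using mult[of f "-1"] by simp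

lemma diff: "N f \<Longrightarrow> N g \<Longrightarrow> N (f - g)"
  using add[OF _ minus, of f g] by simp

text \<open>
  A relation between three terms of the Sylvester sequence of the indeterminate is nontrivial
  modulo every prime \<open>p\<close>, and for \<open>p = 0\<close> simply nontrivial, since otherwise one of these monic
  polynomials would be a unit modulo \<open>p\<close>.
\<close>
lemma sylvester_relation:
  "\<exists>D. N D \<and> (\<forall>p. \<not> is_unit p \<longrightarrow> \<not> of_int p dvd D)"
proof -
  have "coeff \<tau> 0 = 0" by simp
  from dependent[of "sylvester \<tau>", OF coeff_0_sylvester, OF this]
  obtain e :: "nat \<Rightarrow> int" and i where i: "i < 3" "e i \<noteq> 0"
    and N: "N ((\<Prod>i<3. sylvester \<tau> i ^ nat (e i)) - (\<Prod>i<3. sylvester \<tau> i ^ nat (- e i)))"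
    by blast
  have "\<not> of_int p dvd (\<Prod>i<3. sylvester \<tau> i ^ nat (e i)) - (\<Prod>i<3. sylvester \<tau> i ^ nat (- e i))"
    if "\<not> is_unit p" for p
  proof
    assume "of_int p dvd (\<Prod>i<3. sylvester \<tau> i ^ nat (e i)) - (\<Prod>i<3. sylvester \<tau> i ^ nat (- e i))"
    from unit_mod_of_power_relation[where e = e, OF comaximal_sylvester i this]
    obtain w where "of_int p dvd sylvester \<tau> i * w - 1" by blast
    then show False using monic_not_unit_mod[OF _ _ that] sylvester_indeterminate_monic by blast
  qed
  then show ?thesis using N by blast
qed

text \<open>
  The index \<open>m\<close> is positive since polynomials in the ideal have no constant term.
\<close>
lemma low_degree_relation:
  assumes "\<not> is_unit p"
  shows "\<exists>m D1 D2. m > 0 \<and> coeff (of_int p * D1) 0 = 0 \<and> N (of_int p * D1 + \<tau> ^ m * D2)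
    \<and> \<not> p dvd coeff D2 0"
proof -
  obtain D where D: "N D" "\<not> of_int p dvd D" using sylvester_relation assms by blast
  then obtain m D1 D2 where eq: "D = of_int p * D1 + \<tau> ^ m * D2" and nd: "\<not> p dvd coeff D2 0"
    using first_nonmultiple_coeff by blast
  have 0: "p * coeff D1 0 + coeff (\<tau> ^ m) 0 * coeff D2 0 = 0"
    using coeff_0[OF D(1)] unfolding eq by (simp add: of_int_poly coeff_mult_0)
  have "m > 0"
  proof (rule ccontr)
    assume "\<not> m > 0"
    then have "coeff D2 0 = p * (- coeff D1 0)" using 0 by simp
    then show False using nd by (metis dvd_triv_left)
  qed
  then have "coeff (\<tau> ^ m) 0 = 0" by (cases m) auto
  then have "coeff (of_int p * D1) 0 = 0" using 0 by (simp add: of_int_poly)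
  then show ?thesis using \<open>m > 0\<close> D(1) nd unfolding eq by blast
qed

text \<open>
  If \<open>p r = 0\<close>, the relation found above has lowest term \<open>c r\<^sup>m\<close> with \<open>c\<close> invertible modulo \<open>p\<close>,
  so \<open>r\<^sup>m\<close> times an invertible element vanishes and \<open>r\<close> is nilpotent. As \<open>p r = 0\<close>, the element
  \<open>1 + r\<^sup>m\<close> has order dividing \<open>p\<close> as soon as \<open>r\<^sup>2\<^sup>m = 0\<close>; since \<open>1 + R\<close> is torsion-free, the
  nilpotency index comes down to 1.
\<close>
lemma indeterminate_no_torsion:
  assumes p: "Factorial_Ring.prime p" and NpX: "N (of_int p * \<tau>)"
  shows "N \<tau>"
proof -
  have Np: "N (of_int p * f)" if "coeff f 0 = 0" for f
  proof -
    have "\<exists>g. f = pCons 0 g" using that by (rule pCons_0_cases)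
    then obtain g where "f = pCons 0 g" by blast
    then have "of_int p * f = g * (of_int p * \<tau>)" by (simp add: of_int_poly)
    then show ?thesis using mult[OF NpX] by simp
  qed
  have "\<not> is_unit p" using p not_prime_unit by blast
  then obtain m D1 D2 where m: "m > 0" and D1: "coeff (of_int p * D1) 0 = 0"
    and N: "N (of_int p * D1 + \<tau> ^ m * D2)" and nd: "\<not> p dvd coeff D2 0"
    using low_degree_relation by blast
  have "p \<noteq> 0" using p by auto
  then have "coeff D1 0 = 0" using D1 by (simp add: of_int_poly)
  then have "N (of_int p * D1)" by (rule Np)
  from diff[OF N this] have N2: "N (\<tau> ^ m * D2)" by simp
  have Xm0: "coeff (\<tau> ^ m) 0 = 0" using m by (cases m) auto
  have "coprime p (coeff D2 0)" using p nd by (simp add: prime_imp_coprime)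
  then obtain x y where xy: "x * coeff D2 0 + y * p = 1"
    by (metis bezout_int coprime_imp_gcd_eq_1 gcd.commute)
  have "N (\<tau> ^ m * (of_int x * D2 + of_int y * of_int p))"
    using add[OF mult[OF N2, of "of_int x"] Np[of "of_int y * \<tau> ^ m"]] Xm0
    by (simp add: algebra_simps of_int_poly)
  moreover have "coeff (of_int x * D2 + of_int y * of_int p) 0 = 1"
    using xy by (simp add: of_int_poly mult.commute)
  ultimately have "N (\<tau> ^ m)" using cancel Xm0 by blast
  then show ?thesis
    using m
  proof (induction m)
    case (Suc m)
    show ?case
    proof (cases "m = 0")
      case True
      then show ?thesis using Suc.prems by simp
    next
      case False
      have s0: "coeff (\<tau> ^ m) 0 = 0" using False by (cases m) auto
      obtain w where w: "(1 + \<tau> ^ m) ^ nat p = 1 + of_nat (nat p) * \<tau> ^ m + (\<tau> ^ m)\<^sup>2 * w"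
        using power_1_plus by blast
      have "p > 0" using p by (simp add: prime_gt_0_int)
      \<comment> \<open>The square of \<open>\<tau> ^ m\<close> is a multiple of \<open>\<tau> ^ Suc m\<close> because \<open>m > 0\<close>.\<close>
      have "(\<tau> ^ m)\<^sup>2 * w = (\<tau> ^ (m - 1) * w) * \<tau> ^ Suc m"
        using False by (cases m) (simp_all add: power2_eq_square)
      then have "N ((\<tau> ^ m)\<^sup>2 * w)" using mult[OF Suc.prems(1)] by metis
      moreover have "N (of_nat (nat p) * \<tau> ^ m)" using Np[OF s0] \<open>p > 0\<close> by simp
      ultimately have "N ((1 + \<tau> ^ m) ^ nat p - 1)" unfolding w using add by force
      then have "N (1 + \<tau> ^ m - 1)" using root[of "1 + \<tau> ^ m" "nat p"] s0 \<open>p > 0\<close> by simp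
      then show ?thesis using Suc.IH False by simp
    qed
  qed simp
qed

end

locale torsion_free_vanishing_ideal = vanishing_ideal +
  assumes torsion_free: "n \<noteq> 0 \<Longrightarrow> coeff f 0 = 0 \<Longrightarrow> N (of_int n * f) \<Longrightarrow> N f"
begin

text \<open>
  A relation of lowest term \<open>c r\<^sup>m\<close> with \<open>c \<noteq> 0\<close> says that some multiple of \<open>r\<close> acts on \<open>r\<^sup>m R\<close> as
  multiplication by \<open>c\<close>. If \<open>r\<^sup>m\<close> were not zero, the elements of \<open>1 + R\<close> obtained from that
  multiple would act as integers, among them the terms of a Sylvester sequence. As these are
  pairwise coprime and greater than 1, they are multiplicatively independent, so the rank of
  \<open>1 + R\<close> would be at least three.
\<close>
lemma indeterminate_nilpotent: "\<exists>m>0. N (\<tau> ^ m)"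
proof -
  obtain m D1 D2 where m: "m > 0" and "N (\<tau> ^ m * D2)" and c: "coeff D2 0 \<noteq> 0"
    using low_degree_relation[of 0] by auto
  define c where "c = coeff D2 0"
  obtain h where h: "D2 = pCons c h" unfolding c_def using pCons_0_cases by blast
  \<comment> \<open>The extra factor \<open>c\<close> makes the integer \<open>c\<^sup>2\<close> by which \<open>x\<close> acts positive.\<close>
  define x where "x = - (of_int c * \<tau> * h)"
  define acts where "acts f k \<longleftrightarrow> N (\<tau> ^ m * (f - of_int k))" for f and k :: int
  have acts_1: "acts 1 1" unfolding acts_def using zero by simp
  have acts_add: "acts (f + g) (k + l)" if "acts f k" "acts g l" for f g k l
    using add[of "\<tau> ^ m * (f - of_int k)" "\<tau> ^ m * (g - of_int l)"] that
    unfolding acts_def by (simp add: algebra_simps)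
  have acts_mult: "acts (f * g) (k * l)" if "acts f k" "acts g l" for f g k l
    using add[OF mult[of "\<tau> ^ m * (f - of_int k)" g] mult[of "\<tau> ^ m * (g - of_int l)" "of_int k"]] that
    unfolding acts_def by (simp add: algebra_simps)
  have acts_power: "acts (f ^ n) (k ^ n)" if "acts f k" for f k n
    by (induction n) (auto intro: acts_1 acts_mult that)
  have acts_prod: "acts (\<Prod>j\<in>J. f j) (\<Prod>j\<in>J. k j)" if "\<And>j. j \<in> J \<Longrightarrow> acts (f j) (k j)"
    for f k and J :: "nat set"
    using that by (induction J rule: infinite_finite_induct) (auto intro: acts_1 acts_mult)
  have "\<tau> ^ m * (x - of_int (c * c)) = - of_int c * (\<tau> ^ m * D2)"
    unfolding x_def h by (simp add: algebra_simps of_int_poly)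
  then have acts_x: "acts x (c * c)"
    unfolding acts_def using mult[OF \<open>N (\<tau> ^ m * D2)\<close>] by metis
  have acts_sylvester: "acts (sylvester x i) (sylvester (c * c) i)" for i
  proof (induction i rule: less_induct)
    case (less i)
    then show ?case
      by (subst (1 2) sylvester.simps) (intro acts_add acts_1 acts_mult acts_x acts_prod, auto)
  qed
  have "coeff x 0 = 0" unfolding x_def by (simp add: of_int_poly)
  from dependent[of "sylvester x", OF coeff_0_sylvester, OF this]
  obtain e :: "nat \<Rightarrow> int" and i where i: "i < 3" "e i \<noteq> 0"
    and N: "N ((\<Prod>i<3. sylvester x i ^ nat (e i)) - (\<Prod>i<3. sylvester x i ^ nat (- e i)))"
    by blast
  define k where "k e = (\<Prod>i<3. sylvester (c * c) i ^ nat (e i))" for e :: "nat \<Rightarrow> int"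
  have acts_k: "acts (\<Prod>i<3. sylvester x i ^ nat (e i)) (k e)" for e
    unfolding k_def by (intro acts_prod acts_power acts_sylvester)
  have "k e - k (\<lambda>i. - e i) \<noteq> 0"
  proof
    assume "k e - k (\<lambda>i. - e i) = 0"
    then obtain w where "sylvester (c * c) i * w = 1"
      using unit_mod_of_power_relation[of 3 "sylvester (c * c)" i e 0] i comaximal_sylvester
      unfolding k_def by auto
    moreover have "sylvester (c * c) i > 1"
      using c by (intro sylvester_int_gt_1) (simp add: c_def flip: power2_eq_square)
    ultimately show False by (simp add: zmult_eq_1_iff)
  qed
  moreover have "N (of_int (k e - k (\<lambda>i. - e i)) * \<tau> ^ m)"
    using diff[OF mult[OF N, of "\<tau> ^ m"] diff[OF acts_k[of e, unfolded acts_def]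
        acts_k[of "\<lambda>i. - e i", unfolded acts_def]]]
    by (simp add: algebra_simps)
  moreover have "coeff (\<tau> ^ m) 0 = 0" using m by (cases m) auto
  ultimately show ?thesis using torsion_free m by blast
qed

text \<open>
  If \<open>m \<ge> 4\<close> were the nilpotency index of \<open>r\<close>, then \<open>1 + r\<^sup>m\<^sup>-\<^sup>3\<close>, \<open>1 + r\<^sup>m\<^sup>-\<^sup>2\<close> and \<open>1 + r\<^sup>m\<^sup>-\<^sup>1\<close> would be
  multiplicatively independent: multiplying a relation by a suitable power of \<open>r\<close> isolates
  the first nonzero exponent as the coefficient of \<open>r\<^sup>m\<^sup>-\<^sup>1\<close>.
\<close>
lemma indeterminate_cubed: "N (\<tau> ^ 3)"
proof -
  define m where "m = (LEAST m. m > 0 \<and> N (\<tau> ^ m))"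
  have m: "m > 0" "N (\<tau> ^ m)" using LeastI_ex[OF indeterminate_nilpotent] unfolding m_def by auto
  have least: "m \<le> n" if "n > 0" "N (\<tau> ^ n)" for n
    using that unfolding m_def by (auto intro: Least_le)
  have high: "N (\<tau> ^ n * f)" if "n \<ge> m" for n f
  proof -
    have "\<tau> ^ n * f = (\<tau> ^ (n - m) * f) * \<tau> ^ m"
      using that by (simp add: power_add[symmetric] mult.commute mult.left_commute)
    then show ?thesis using mult[OF m(2)] by metis
  qed
  have "m \<le> 3"
  proof (rule ccontr)
    assume "\<not> m \<le> 3"
    then obtain l where l: "m = l + 4" by (metis add.commute le_Suc_ex not_less_eq_eq
        eval_nat_numeral(2) semiring_norm(26,27,28))
    have "coeff (1 + \<tau> ^ (l + 1 + i)) 0 = 1" for i by simp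
    then obtain e :: "nat \<Rightarrow> int" where e: "\<exists>i<3. e i \<noteq> 0"
      and N: "N ((\<Prod>i<3. (1 + \<tau> ^ (l + 1 + i)) ^ nat (e i)) - (\<Prod>i<3. (1 + \<tau> ^ (l + 1 + i)) ^ nat (- e i)))"
      using dependent[of "\<lambda>i. 1 + \<tau> ^ (l + 1 + i)"] by blast
    define i where "i = (LEAST i. i < 3 \<and> e i \<noteq> 0)"
    have i: "i < 3" "e i \<noteq> 0" using LeastI_ex[OF e] unfolding i_def by auto
    have below: "e j = 0" if "j < i" for j
      using not_less_Least[of j "\<lambda>i. i < 3 \<and> e i \<noteq> 0"] that i(1) unfolding i_def by auto
    \<comment> \<open>With \<open>2 - i\<close>, the factor of index \<open>i\<close> contributes its linear term in degree \<open>l + 3 = m - 1\<close>,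
      while everything from later factors has degree at least \<open>m\<close>.\<close>
    have expand: "N (\<tau> ^ (2 - i) * (\<Prod>j<k. (1 + \<tau> ^ (l + 1 + j)) ^ n j)
        - \<tau> ^ (2 - i) - (if i < k then of_nat (n i) * \<tau> ^ (l + 3) else 0))"
      if n: "\<And>j. j < i \<Longrightarrow> n j = 0" for n :: "nat \<Rightarrow> nat" and k
    proof (induction k)
      case 0
      show ?case using zero by simp
    next
      case (Suc k)
      let ?s = "\<tau> ^ (l + 1 + k)"
      obtain w where w: "(1 + ?s) ^ n k = 1 + of_nat (n k) * ?s + ?s\<^sup>2 * w"
        using power_1_plus by blast
      let ?P = "\<Prod>j<k. (1 + \<tau> ^ (l + 1 + j)) ^ n j"
      consider "k < i" | "k = i" | "k > i" by linarith
      then show ?case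
      proof cases
        case 1
        then show ?thesis using Suc n by simp
      next
        case 2
        have "?s\<^sup>2 * \<tau> ^ (2 - i) = \<tau> ^ (l + 1 + i + (l + 1 + i) + (2 - i))"
          by (simp add: power2_eq_square power_add 2)
        also have "l + 1 + i + (l + 1 + i) + (2 - i) = m + (l + i)" using i(1) l by simp
        finally have *: "?s\<^sup>2 * \<tau> ^ (2 - i) = \<tau> ^ (m + (l + i))" .
        have "\<tau> ^ (2 - i) * (?s\<^sup>2 * w) = (?s\<^sup>2 * \<tau> ^ (2 - i)) * w"
          by (simp only: ac_simps)
        then have "\<tau> ^ (2 - i) * (?s\<^sup>2 * w) = \<tau> ^ (m + (l + i)) * w" by (simp only: *)
        then have a: "N (\<tau> ^ (2 - i) * (?s\<^sup>2 * w))" using high[of "m + (l + i)" w] by (simp only:)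
        have b: "\<tau> ^ (2 - i) * ?s = \<tau> ^ (l + 3)"
          unfolding power_add[symmetric] using i(1) 2 by (intro arg_cong[where f="power \<tau>"]) simp
        have near: "N (\<tau> ^ (2 - i) * ?P * (1 + ?s) ^ n k - \<tau> ^ (2 - i) * (1 + ?s) ^ n k)"
          using mult_right[OF Suc, of "(1 + ?s) ^ n k"] 2 by (simp add: algebra_simps)
        have ring: "x - y - z * (y * v) = (x - y * (1 + z * v + r)) + y * r"
          for x y z v r :: "int poly" by (simp add: algebra_simps)
        have "N (\<tau> ^ (2 - i) * ?P * (1 + ?s) ^ n k - \<tau> ^ (2 - i) - of_nat (n k) * (\<tau> ^ (2 - i) * ?s))"
          unfolding w ring[where r = "?s\<^sup>2 * w"] by (rule add[OF near[unfolded w] a])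
        then show ?thesis unfolding b using 2 by (simp add: mult.assoc)
      next
        case 3
        have c: "N (\<tau> ^ r * ((1 + ?s) ^ n k - 1))" if "r \<ge> 2 - i" for r
        proof -
          have "\<tau> ^ r * ((1 + ?s) ^ n k - 1) = \<tau> ^ (r + (l + 1 + k)) * (of_nat (n k) + ?s * w)"
            unfolding w by (simp add: algebra_simps power2_eq_square power_add)
          then show ?thesis using high[of "r + (l + 1 + k)"] that 3 l by simp
        qed
        have "N (\<tau> ^ (2 - i) * ((1 + ?s) ^ n k - 1) + of_nat (n i) * (\<tau> ^ (l + 3) * ((1 + ?s) ^ n k - 1)))"
          by (intro add mult c) auto
        from add[OF mult_right[OF Suc, of "(1 + ?s) ^ n k"] this]
        show ?thesis using 3 by (simp add: algebra_simps)
      qed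
    qed
    have "N (of_int (e i) * \<tau> ^ (l + 3))"
    proof -
      have "N (of_nat (nat (e i)) * \<tau> ^ (l + 3) - of_nat (nat (- e i)) * \<tau> ^ (l + 3))"
        using diff[OF mult[OF N, of "\<tau> ^ (2 - i)"] diff[OF expand[of "\<lambda>i. nat (e i)" 3]
            expand[of "\<lambda>i. nat (- e i)" 3]]] below i(1)
        by (simp add: algebra_simps)
      moreover have "of_int (e i) = (of_nat (nat (e i)) - of_nat (nat (- e i)) :: int poly)"
        by (cases "e i \<ge> 0") simp_all
      ultimately show ?thesis by (simp only: left_diff_distrib)
    qed
    moreover have "coeff (\<tau> ^ (l + 3)) 0 = 0" by (simp add: coeff_0_power)
    ultimately have "N (\<tau> ^ (l + 3))" using torsion_free i(2) by blast
    then show False using least[of "l + 3"] l by simp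
  qed
  then show ?thesis using high[of 3 1] by simp
qed

end

section \<open>The radical ring of a brace with commutative multiplicative group\<close>

text \<open>
  If both groups of a skew brace are commutative, then \<open>(A, \<cdot>)\<close> is the additive group of a
  commutative radical ring with product \<open>star\<close>, and \<open>a \<circ> b = a + b + a b\<close> in additive notation.
\<close>
locale radical_brace = add: comm_group A + mul: comm_group M
  for A :: "'a monoid" (structure) and M :: "'a monoid" +
  assumes carrier_eq [simp]: "carrier M = carrier A"
    and compat: "\<lbrakk>a \<in> carrier A; b \<in> carrier A; c \<in> carrier A\<rbrakk> \<Longrightarrow>
      a \<otimes>\<^bsub>M\<^esub> (b \<otimes> c) = (a \<otimes>\<^bsub>M\<^esub> b) \<otimes> inv a \<otimes> (a \<otimes>\<^bsub>M\<^esub> c)"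
begin

definition star :: "'a \<Rightarrow> 'a \<Rightarrow> 'a" (infixl "\<star>" 75) where
  "a \<star> b = inv a \<otimes> (a \<otimes>\<^bsub>M\<^esub> b) \<otimes> inv b"

lemma M_closed [simp]: "a \<in> carrier A \<Longrightarrow> b \<in> carrier A \<Longrightarrow> a \<otimes>\<^bsub>M\<^esub> b \<in> carrier A"
  using mul.m_closed by simp

lemma star_closed [simp]: "a \<in> carrier A \<Longrightarrow> b \<in> carrier A \<Longrightarrow> a \<star> b \<in> carrier A"
  by (simp add: star_def)

lemma cancel_inv [simp]:
  assumes "x \<in> carrier A" "y \<in> carrier A"
  shows "x \<otimes> (inv x \<otimes> y) = y" "inv x \<otimes> (x \<otimes> y) = y"
  using assms by (simp_all flip: add.m_assoc)

lemma circ_eq: "a \<in> carrier A \<Longrightarrow> b \<in> carrier A \<Longrightarrow> a \<otimes>\<^bsub>M\<^esub> b = a \<otimes> b \<otimes> (a \<star> b)"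
  by (simp add: star_def add.m_ac)

lemma star_commute: "a \<in> carrier A \<Longrightarrow> b \<in> carrier A \<Longrightarrow> a \<star> b = b \<star> a"
  using mul.m_comm[of a b] by (simp add: star_def add.m_ac)

lemma star_add:
  assumes "a \<in> carrier A" "b \<in> carrier A" "c \<in> carrier A"
  shows "a \<star> (b \<otimes> c) = (a \<star> b) \<otimes> (a \<star> c)"
  using assms by (simp add: star_def compat add.inv_mult_group add.m_ac)

lemma add_star:
  assumes "a \<in> carrier A" "b \<in> carrier A" "c \<in> carrier A"
  shows "(b \<otimes> c) \<star> a = (b \<star> a) \<otimes> (c \<star> a)"
  using assms star_add[OF assms] by (simp add: star_commute[of _ a])

lemma star_hom: "a \<in> carrier A \<Longrightarrow> group_hom A A (\<lambda>b. a \<star> b)"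
  by unfold_locales (simp add: hom_def star_add)

lemma star_one [simp]: "a \<in> carrier A \<Longrightarrow> a \<star> \<one> = \<one>"
  using group_hom.hom_one[OF star_hom] .

lemma one_star [simp]: "a \<in> carrier A \<Longrightarrow> \<one> \<star> a = \<one>"
  by (simp add: star_commute[of \<one>])

lemma star_inv: "a \<in> carrier A \<Longrightarrow> b \<in> carrier A \<Longrightarrow> a \<star> inv b = inv (a \<star> b)"
  using group_hom.hom_inv[OF star_hom] .

lemma star_int_pow:
  "a \<in> carrier A \<Longrightarrow> b \<in> carrier A \<Longrightarrow> a \<star> (b [^] (n::int)) = (a \<star> b) [^] n"
  using group_hom.hom_int_pow[OF star_hom] .

lemma one_M [simp]: "\<one>\<^bsub>M\<^esub> = \<one>"
proof -
  have "\<one> \<otimes>\<^bsub>M\<^esub> \<one> = \<one>" 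
    using circ_eq[OF add.one_closed add.one_closed] by (simp only: add.l_one one_star add.one_closed)
  moreover have "\<one> \<in> carrier M" by simp
  ultimately show ?thesis by (metis mul.l_cancel_one)
qed

lemma one_circ [simp]: "a \<in> carrier A \<Longrightarrow> \<one> \<otimes>\<^bsub>M\<^esub> a = a"
  by (metis carrier_eq mul.l_one one_M)

text \<open>
  Both sides are what remains of the triple products \<open>(a \<circ> b) \<circ> c = a \<circ> (b \<circ> c)\<close> once the terms
  symmetric in the three factors are removed.
\<close>
lemma star_assoc:
  assumes [simp]: "a \<in> carrier A" "b \<in> carrier A" "c \<in> carrier A"
  shows "(a \<star> b) \<star> c = a \<star> (b \<star> c)"
proof -
  have "(a \<otimes> b \<otimes> c \<otimes> a \<star> b \<otimes> a \<star> c \<otimes> b \<star> c) \<otimes> (a \<star> b) \<star> c = (a \<otimes>\<^bsub>M\<^esub> b) \<otimes>\<^bsub>M\<^esub> c"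
    by (simp add: circ_eq add_star add.m_ac)
  also have "\<dots> = a \<otimes>\<^bsub>M\<^esub> (b \<otimes>\<^bsub>M\<^esub> c)" by (rule mul.m_assoc) simp_all
  also have "\<dots> = (a \<otimes> b \<otimes> c \<otimes> a \<star> b \<otimes> a \<star> c \<otimes> b \<star> c) \<otimes> a \<star> (b \<star> c)"
    by (simp add: circ_eq star_add add.m_ac)
  finally show ?thesis by simp
qed

lemma star_left_commute:
  "a \<in> carrier A \<Longrightarrow> b \<in> carrier A \<Longrightarrow> c \<in> carrier A \<Longrightarrow> a \<star> (b \<star> c) = b \<star> (a \<star> c)"
  by (metis star_assoc star_commute)

text \<open>
  In ring notation: \<open>1 + b\<close> is invertible, so \<open>a (1 + b) = 0\<close> forces \<open>a = 0\<close>.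
\<close>
lemma eq_one_if_star_eq_inv:
  assumes [simp]: "a \<in> carrier A" "b \<in> carrier A" and "a \<otimes> (a \<star> b) = \<one>"
  shows "a = \<one>"
proof -
  have "a \<otimes>\<^bsub>M\<^esub> b = a \<otimes> (a \<star> b) \<otimes> b" by (simp add: circ_eq add.m_ac)
  then have "a \<otimes>\<^bsub>M\<^esub> b = \<one> \<otimes>\<^bsub>M\<^esub> b" using assms(3) mul.l_one[of b] by simp
  then show ?thesis by (metis assms(1,2) carrier_eq add.one_closed mul.r_cancel)
qed

text \<open>
  In ring notation this is \<open>r q(r)\<close>. The ring has no unit, so only polynomials without constant term
  can be evaluated; the factor \<open>r\<close> lets \<open>q\<close> range over all of \<open>\<int>[X]\<close>.
\<close>
definition eval_at :: "'a \<Rightarrow> int poly \<Rightarrow> 'a" where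
  "eval_at r q = fold_coeffs (\<lambda>c x. r [^] c \<otimes> (r \<star> x)) q \<one>"

context
  fixes r
  assumes r [simp]: "r \<in> carrier A"
begin

lemma eval_at_0 [simp]: "eval_at r 0 = \<one>"
  by (simp add: eval_at_def)

lemma eval_at_pCons [simp]: "eval_at r (pCons c q) = r [^] c \<otimes> (r \<star> eval_at r q)"
  by (cases "q = 0 \<and> c = 0") (auto simp: eval_at_def)

lemma eval_at_closed [simp]: "eval_at r q \<in> carrier A"
  by (induction q) auto

lemma eval_at_add: "eval_at r (p + q) = eval_at r p \<otimes> eval_at r q"
  by (induction p q rule: poly_induct2) (simp_all add: star_add add.int_pow_mult add.m_ac)

lemma eval_at_smult: "eval_at r (smult c q) = eval_at r q [^] c"
  by (induction q)
    (simp_all add: star_int_pow add.int_pow_distrib add.int_pow_pow mult.commute)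

lemma eval_at_mult: "eval_at r (pCons 0 (p * q)) = eval_at r p \<star> eval_at r q"
proof (induction p)
  case (pCons c p)
  note IH = pCons.IH[simplified]
  have "eval_at r (pCons 0 (pCons c p * q))
      = eval_at r (smult c (pCons 0 q)) \<otimes> (r \<star> eval_at r (pCons 0 (p * q)))"
    by (simp add: eval_at_add star_add eval_at_smult star_int_pow del: smult_pCons)
  also have "\<dots> = (r [^] c) \<star> eval_at r q \<otimes> (r \<star> eval_at r p) \<star> eval_at r q"
    by (simp add: IH eval_at_smult star_assoc star_commute[of "r [^] c"] star_int_pow
        star_commute[of "eval_at r q" r] del: smult_pCons)
  finally show ?case by (simp add: add_star)
qed simp

definition vanishes where
  "vanishes f \<longleftrightarrow> (\<exists>q. f = pCons 0 q \<and> eval_at r q = \<one>)"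

text \<open>
  For \<open>u\<close> with constant term 1 this is \<open>u(r) - 1\<close>, the element of the brace that represents
  the unit \<open>u(r)\<close> of the ring extended by 1.
\<close>
definition unit_value :: "int poly \<Rightarrow> 'a" where
  "unit_value u = eval_at r (poly_shift 1 u)"

lemma vanishes_pCons [simp]: "vanishes (pCons c q) \<longleftrightarrow> c = 0 \<and> eval_at r q = \<one>"
  by (auto simp: vanishes_def)

lemma unit_value_closed [simp]: "unit_value u \<in> carrier A"
  by (simp add: unit_value_def)

lemma poly_shift_1_pCons: "poly_shift 1 (pCons c q) = q"
  by (intro poly_eqI) (simp add: coeff_poly_shift)

lemma unit_value_pCons [simp]: "unit_value (pCons c q) = eval_at r q"
  by (simp only: unit_value_def poly_shift_1_pCons)

lemma unit_value_1: "unit_value 1 = \<one>"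
  by (simp add: one_pCons)

text \<open>
  The circle operation is multiplication of units: \<open>(1 + a) (1 + b) = 1 + a \<circ> b\<close>.
\<close>
lemma unit_value_mult:
  assumes "coeff u 0 = 1" "coeff v 0 = 1"
  shows "unit_value (u * v) = unit_value u \<otimes>\<^bsub>M\<^esub> unit_value v"
proof -
  obtain p q where "u = pCons 1 p" "v = pCons 1 q" using assms pCons_0_cases by blast
  moreover have "pCons 1 p * pCons 1 q = pCons 1 (p + q + pCons 0 (p * q))" by simp
  ultimately show ?thesis
    by (simp only: unit_value_pCons eval_at_add eval_at_mult circ_eq eval_at_closed)
qed

lemma unit_value_power:
  assumes "coeff u 0 = 1"
  shows "unit_value (u ^ n) = unit_value u [^]\<^bsub>M\<^esub> n"
  using assms
  by (induction n)
    (simp_all add: unit_value_1 unit_value_mult coeff_0_power power_Suc2 del: power_Suc)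

lemma vanishes_diff_iff:
  assumes "coeff u 0 = 1" "coeff v 0 = 1"
  shows "vanishes (u - v) \<longleftrightarrow> unit_value u = unit_value v"
proof -
  obtain p q where uv: "u = pCons 1 p" "v = pCons 1 q" using assms pCons_0_cases by blast
  have "eval_at r p = eval_at r (p - q) \<otimes> eval_at r q" by (simp flip: eval_at_add)
  then show ?thesis unfolding uv by auto
qed

end

end

lemma sum_lessThan_3: "(\<Sum>i<3. f i) = f 0 + f 1 + (f (2::nat) :: 'b :: comm_monoid_add)"
  by (simp add: eval_nat_numeral)

lemma orthogonal_to_vector:
  fixes u :: "nat \<Rightarrow> int"
  shows "\<exists>e. (\<exists>i<3. e i \<noteq> 0) \<and> (\<Sum>i<3. e i * u i) = 0"
proof (cases "u 0 = 0 \<and> u 1 = 0")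
  case True
  then show ?thesis
    by (intro exI[of _ "\<lambda>i. if i = 0 then 1 else 0"]) (auto simp: sum_lessThan_3)
next
  case False
  then show ?thesis
    by (intro exI[of _ "\<lambda>i. if i = 0 then u 1 else if i = 1 then - u 0 else 0"])
      (auto simp: sum_lessThan_3 intro: exI[of _ 0] exI[of _ "Suc 0"])
qed

text \<open>
  The cross product works unless \<open>u\<close> and \<open>v\<close> are parallel, and then it suffices to be orthogonal to
  a nonzero one of them.
\<close>
lemma orthogonal_to_two_vectors:
  fixes u v :: "nat \<Rightarrow> int"
  shows "\<exists>e. (\<exists>i<3. e i \<noteq> 0) \<and> (\<Sum>i<3. e i * u i) = 0 \<and> (\<Sum>i<3. e i * v i) = 0"
proof (cases "\<forall>i<3. \<forall>j<3. u i * v j = u j * v i")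
  case True
  show ?thesis
  proof (cases "\<exists>i<3. u i \<noteq> 0")
    case u: True
    then obtain i where i: "i < 3" "u i \<noteq> 0" by blast
    obtain e where e: "\<exists>i<3. e i \<noteq> 0" "(\<Sum>i<3. e i * u i) = 0"
      using orthogonal_to_vector by blast
    have "u i * (\<Sum>j<3. e j * v j) = (\<Sum>j<3. e j * (u i * v j))"
      by (simp add: sum_distrib_left mult.left_commute)
    also have "\<dots> = (\<Sum>j<3. e j * (u j * v i))" using True i by (intro sum.cong) auto
    also have "\<dots> = (\<Sum>j<3. e j * u j) * v i" by (simp add: sum_distrib_right mult.assoc)
    finally show ?thesis using e i by auto
  next
    case False
    then show ?thesis using orthogonal_to_vector[of v] by auto
  qed
next
  case False
  define e where "e i = (if i = 0 then u 1 * v 2 - u 2 * v 1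
    else if i = 1 then u 2 * v 0 - u 0 * v 2 else u 0 * v 1 - u 1 * v 0)" for i :: nat
  have "\<exists>i<3. e i \<noteq> 0"
  proof (rule ccontr)
    assume "\<not> (\<exists>i<3. e i \<noteq> 0)"
    then have "e 0 = 0" "e 1 = 0" "e 2 = 0" by auto
    then have eqs: "u 1 * v 2 = u 2 * v 1" "u 2 * v 0 = u 0 * v 2" "u 0 * v 1 = u 1 * v 0"
      by (auto simp: e_def)
    have "i = 0 \<or> i = 1 \<or> i = 2" if "i < 3" for i :: nat using that by linarith
    then have "\<forall>i<3. \<forall>j<3. u i * v j = u j * v i" using eqs by metis
    then show False using False by blast
  qed
  moreover have "(\<Sum>i<3. e i * u i) = 0" "(\<Sum>i<3. e i * v i) = 0"
    by (simp_all add: e_def sum_lessThan_3 algebra_simps)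
  ultimately show ?thesis by blast
qed

section \<open>Braces with multiplicative group of rank two\<close>

lemma coeff_0_prod_powers:
  fixes s :: "nat \<Rightarrow> 'b::comm_ring_1 poly" and k :: nat
  assumes "\<And>i. coeff (s i) 0 = 1"
  shows "coeff (\<Prod>i<k. s i ^ n i) 0 = 1"
  by (induction k) (simp_all add: coeff_mult_0 coeff_0_power assms)

text \<open>
  The functions \<open>\<phi>\<close> and \<open>\<psi>\<close> are the two coordinates of an embedding of the multiplicative group
  into \<open>\<int>\<^sup>2\<close>.
\<close>
locale rank_two_radical_brace = radical_brace A M for A :: "'a monoid" (structure) and M +
  fixes \<phi> \<psi> :: "'a \<Rightarrow> int"
  assumes \<phi>_mult: "x \<in> carrier A \<Longrightarrow> y \<in> carrier A \<Longrightarrow> \<phi> (x \<otimes>\<^bsub>M\<^esub> y) = \<phi> x + \<phi> y"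
    and \<psi>_mult: "x \<in> carrier A \<Longrightarrow> y \<in> carrier A \<Longrightarrow> \<psi> (x \<otimes>\<^bsub>M\<^esub> y) = \<psi> x + \<psi> y"
    and coordinates_inj: "x \<in> carrier A \<Longrightarrow> y \<in> carrier A \<Longrightarrow> \<phi> x = \<phi> y \<Longrightarrow> \<psi> x = \<psi> y \<Longrightarrow> x = y"
begin

context
  fixes \<chi> :: "'a \<Rightarrow> int"
  assumes \<chi>_mult: "\<And>x y. x \<in> carrier A \<Longrightarrow> y \<in> carrier A \<Longrightarrow> \<chi> (x \<otimes>\<^bsub>M\<^esub> y) = \<chi> x + \<chi> y"
begin

lemma hom_one: "\<chi> \<one> = 0"
  using \<chi>_mult[of \<one> \<one>] by simp

lemma hom_nat_pow:
  assumes "x \<in> carrier A"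
  shows "\<chi> (x [^]\<^bsub>M\<^esub> (n::nat)) = int n * \<chi> x"
proof (induction n)
  case (Suc n)
  have "x [^]\<^bsub>M\<^esub> n \<in> carrier A" using assms mul.nat_pow_closed by simp
  then show ?case using Suc assms by (simp add: \<chi>_mult algebra_simps)
qed (simp add: hom_one)

lemma hom_unit_value_prod:
  assumes r: "r \<in> carrier A" and s: "\<And>i::nat. coeff (s i) 0 = 1"
  shows "\<chi> (unit_value r (\<Prod>i<k. s i ^ n i)) = (\<Sum>i<k. int (n i) * \<chi> (unit_value r (s i)))"
proof (induction k)
  case 0
  then show ?case using hom_one unit_value_1[OF r] by simp
next
  case (Suc k)
  have 1: "coeff (\<Prod>i<k. s i ^ n i) 0 = 1" using s by (rule coeff_0_prod_powers)
  show ?case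
    using Suc 1 r s
    by (simp add: unit_value_mult unit_value_power coeff_0_power \<chi>_mult hom_nat_pow
        mul.nat_pow_closed[simplified])
qed

end

lemma vanishing_ideal_vanishes:
  assumes r [simp]: "r \<in> carrier A"
  shows "vanishing_ideal (vanishes r)"
proof
  fix f g assume "vanishes r f" "vanishes r g"
  then show "vanishes r (f + g)" by (auto simp: vanishes_def eval_at_add)
next
  fix f h assume "vanishes r f"
  then obtain q where q: "f = pCons 0 q" "eval_at r q = \<one>" by (auto simp: vanishes_def)
  have "eval_at r (h * q) = \<one>"
    by (induction h) (simp_all add: eval_at_add eval_at_smult q(2))
  then show "vanishes r (h * f)" by (simp add: q(1))
next
  fix f assume "vanishes r f"
  then show "coeff f 0 = 0" by (auto simp: vanishes_def)
next
  fix f u :: "int poly" assume 0: "coeff f 0 = 0" and 1: "coeff u 0 = 1" and N: "vanishes r (f * u)"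
  obtain q h where fu: "f = pCons 0 q" "u = pCons 1 h"
    using pCons_0_cases[OF 0] pCons_0_cases[OF 1] by blast
  have "f * u = pCons 0 (q + pCons 0 (q * h))" unfolding fu by simp
  then have "eval_at r (q + pCons 0 (q * h)) = \<one>" using N by simp
  then have "eval_at r q \<otimes> (eval_at r q \<star> eval_at r h) = \<one>"
    by (simp only: eval_at_add eval_at_mult r)
  then have "eval_at r q = \<one>" by (rule eq_one_if_star_eq_inv[rotated 2]) simp_all
  then show "vanishes r f" unfolding fu by simp
next
  fix u :: "int poly" and n :: nat assume u: "coeff u 0 = 1" "n > 0" "vanishes r (u ^ n - 1)"
  let ?x = "unit_value r u"
  have "?x [^]\<^bsub>M\<^esub> n = \<one>"
    using u vanishes_diff_iff[of r "u ^ n" 1] by (simp add: coeff_0_power unit_value_power unit_value_1)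
  then have "\<phi> ?x = 0" "\<psi> ?x = 0"
    using hom_nat_pow[OF \<phi>_mult, of ?x n] hom_nat_pow[OF \<psi>_mult, of ?x n]
      hom_one[OF \<phi>_mult] hom_one[OF \<psi>_mult] u(2) by simp_all
  then have "?x = \<one>"
    using hom_one[OF \<phi>_mult] hom_one[OF \<psi>_mult] by (intro coordinates_inj) simp_all
  then show "vanishes r (u - 1)"
    using vanishes_diff_iff[OF r u(1), of 1] by (simp add: unit_value_1)
next
  fix s :: "nat \<Rightarrow> int poly" assume s: "\<And>i. coeff (s i) 0 = 1"
  obtain e where e: "\<exists>i<3. e i \<noteq> 0"
    and sums: "(\<Sum>i<3. e i * \<phi> (unit_value r (s i))) = 0" "(\<Sum>i<3. e i * \<psi> (unit_value r (s i))) = 0"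
    using orthogonal_to_two_vectors[of "\<lambda>i. \<phi> (unit_value r (s i))" "\<lambda>i. \<psi> (unit_value r (s i))"]
    by blast
  let ?P = "\<lambda>e. \<Prod>i<3. s i ^ nat (e i)"
  have eq: "\<chi> (unit_value r (?P e)) = \<chi> (unit_value r (?P (\<lambda>i. - e i)))"
    if \<chi>: "\<And>x y. x \<in> carrier A \<Longrightarrow> y \<in> carrier A \<Longrightarrow> \<chi> (x \<otimes>\<^bsub>M\<^esub> y) = \<chi> x + \<chi> y"
      and sum: "(\<Sum>i<3. e i * \<chi> (unit_value r (s i))) = 0" for \<chi>
  proof -
    have "\<chi> (unit_value r (?P e)) - \<chi> (unit_value r (?P (\<lambda>i. - e i)))
        = (\<Sum>i<3. (int (nat (e i)) - int (nat (- e i))) * \<chi> (unit_value r (s i)))"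
      by (simp only: hom_unit_value_prod[OF \<chi> r s] left_diff_distrib sum_subtractf)
    also have "\<dots> = (\<Sum>i<3. e i * \<chi> (unit_value r (s i)))" by (intro sum.cong) auto
    finally show ?thesis using sum by simp
  qed
  have c: "coeff (?P e) 0 = 1" for e
    using s by (rule coeff_0_prod_powers)
  have "unit_value r (?P e) = unit_value r (?P (\<lambda>i. - e i))"
    using eq[OF \<phi>_mult sums(1)] eq[OF \<psi>_mult sums(2)] by (intro coordinates_inj) simp_all
  then have "vanishes r (?P e - ?P (\<lambda>i. - e i))"
    by (rule vanishes_diff_iff[OF r c c, THEN iffD2])
  then show "\<exists>e :: nat \<Rightarrow> int. (\<exists>i<3. e i \<noteq> 0) \<and>
      vanishes r ((\<Prod>i<3. s i ^ nat (e i)) - (\<Prod>i<3. s i ^ nat (- e i)))"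
    using e by blast
qed

lemma prime_torsion_free:
  assumes x: "x \<in> carrier A" and p: "Factorial_Ring.prime (p::int)" and "x [^] p = \<one>"
  shows "x = \<one>"
proof -
  interpret vanishing_ideal "vanishes x" using x by (rule vanishing_ideal_vanishes)
  have "vanishes x (of_int p * \<tau>)" using assms by (simp add: of_int_poly)
  then have "vanishes x \<tau>" by (rule indeterminate_no_torsion[OF p])
  then show ?thesis using x by simp
qed

lemma torsion_free_nat:
  assumes x: "x \<in> carrier A" and "n > 0" "x [^] (n::nat) = \<one>"
  shows "x = \<one>"
  using assms(2,3)
proof (induction n rule: less_induct)
  case (less n)
  show ?case
  proof (cases "n = 1")
    case True
    then show ?thesis using less.prems(2) x by simp
  next
    case False
    then obtain p where p: "Factorial_Ring.prime p" "p dvd n" using prime_factor_nat[OF False] by blast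
    then obtain m where m: "n = p * m" by (auto simp: dvd_def)
    have "(x [^] m) [^] p = \<one>"
      using less.prems(2) add.nat_pow_pow[OF x, of m p] unfolding m mult.commute[of p m] by (rule trans[rotated])
    then have "(x [^] m) [^] int p = \<one>" by (simp only: int_pow_int)
    then have "x [^] m = \<one>"
      by (rule prime_torsion_free[OF add.nat_pow_closed[OF x] prime_nat_int_transfer[THEN iffD2, OF p(1)]])
    moreover have "m > 0" using less.prems(1) m by simp
    moreover have "m < n" using prime_gt_1_nat[OF p(1)] \<open>m > 0\<close> unfolding m by simp
    ultimately show ?thesis using less.IH by blast
  qed
qed

lemma torsion_free_int:
  assumes x: "x \<in> carrier A" and n: "n \<noteq> 0" "x [^] (n::int) = \<one>"
  shows "x = \<one>"
proof (rule torsion_free_nat[OF x])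
  have "x [^] \<bar>n\<bar> = \<one>"
    using n(2) x by (cases "n \<ge> 0") (simp_all add: add.int_pow_neg)
  then show "x [^] nat \<bar>n\<bar> = \<one>" by (simp flip: int_pow_int)
qed (use n in simp)

lemma cube_zero:
  assumes r: "r \<in> carrier A"
  shows "r \<star> (r \<star> r) = \<one>"
proof -
  interpret vanishing_ideal "vanishes r" using r by (rule vanishing_ideal_vanishes)
  interpret torsion_free_vanishing_ideal "vanishes r"
  proof
    fix n :: int and f :: "int poly"
    assume n: "n \<noteq> 0" and "coeff f 0 = 0" and N: "vanishes r (of_int n * f)"
    then obtain q where f: "f = pCons 0 q" using pCons_0_cases by blast
    have "eval_at r q [^] n = \<one>" using N r by (simp add: f of_int_poly eval_at_smult)
    then show "vanishes r f" using torsion_free_int n r by (simp add: f)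
  qed
  have "vanishes r [:0, 0, 0, 1:]" using indeterminate_cubed by (simp add: eval_nat_numeral)
  then show ?thesis using r by simp
qed

text \<open>
  Polarization: expanding \<open>(x + y)\<^sup>3 = 0\<close> gives \<open>3 x\<^sup>2 y + 3 x y\<^sup>2 = 0\<close>, and replacing \<open>y\<close> by \<open>- y\<close> changes
  the sign of the first term only. Adding the two equations yields \<open>6 x y\<^sup>2 = 0\<close>.
\<close>
lemma star_square_zero:
  assumes x [simp]: "x \<in> carrier A" and y [simp]: "y \<in> carrier A"
  shows "x \<star> (y \<star> y) = \<one>"
proof -
  have polar: "x \<star> (x \<star> y) \<otimes> x \<star> (x \<star> y) \<otimes> x \<star> (x \<star> y)
      \<otimes> (x \<star> (y \<star> y) \<otimes> x \<star> (y \<star> y) \<otimes> x \<star> (y \<star> y)) = \<one>"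
    if y [simp]: "y \<in> carrier A" for y
  proof -
    have "\<one> = (x \<otimes> y) \<star> ((x \<otimes> y) \<star> (x \<otimes> y))" by (simp add: cube_zero)
    also have "\<dots> = x \<star> (x \<star> y) \<otimes> x \<star> (x \<star> y) \<otimes> x \<star> (x \<star> y)
      \<otimes> (x \<star> (y \<star> y) \<otimes> x \<star> (y \<star> y) \<otimes> x \<star> (y \<star> y))"
      by (simp add: star_add add_star cube_zero star_commute[of y x] star_left_commute[of y x] add.m_ac)
    finally show ?thesis by simp
  qed
  define u v where "u = x \<star> (x \<star> y)" and "v = x \<star> (y \<star> y)"
  have [simp]: "u \<in> carrier A" "v \<in> carrier A" unfolding u_def v_def by simp_all
  have u': "x \<star> (x \<star> inv y) = inv u" unfolding u_def by (simp add: star_inv)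
  have "inv y \<star> inv y = y \<star> y" by (simp add: star_inv star_commute[of "inv y" y])
  then have v': "x \<star> (inv y \<star> inv y) = v" unfolding v_def by simp
  define w where "w = u \<otimes> u \<otimes> u"
  define t where "t = v \<otimes> v \<otimes> v"
  have [simp]: "w \<in> carrier A" "t \<in> carrier A" unfolding w_def t_def by simp_all
  have "inv u \<otimes> inv u \<otimes> inv u = inv w" by (simp add: w_def add.inv_mult_group add.m_assoc)
  then have wt: "w \<otimes> t = \<one>" "inv w \<otimes> t = \<one>"
    using polar[OF y] polar[of "inv y"]
    unfolding u' v' u_def[symmetric] v_def[symmetric] w_def t_def by simp_all
  from wt(1) have "inv w = t" using add.inv_equality[of t w] by (simp add: add.m_comm)
  then have "t \<otimes> t = \<one>" using wt(2) by simp
  then have "v [^] (6::nat) = \<one>" unfolding t_def by (simp add: eval_nat_numeral add.m_ac)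
  then show ?thesis using torsion_free_nat[of v 6] unfolding v_def by simp
qed

lemma triple_product_zero:
  assumes [simp]: "x \<in> carrier A" "y \<in> carrier A" "z \<in> carrier A"
  shows "x \<star> (y \<star> z) = \<one>"
proof -
  have "\<one> = x \<star> ((y \<otimes> z) \<star> (y \<otimes> z))" by (simp add: star_square_zero)
  also have "\<dots> = x \<star> (y \<star> z) \<otimes> x \<star> (y \<star> z)"
    by (simp add: star_add add_star star_square_zero star_commute[of z y])
  also have "\<dots> = (x \<star> (y \<star> z)) [^] (2::nat)" by (simp add: eval_nat_numeral)
  finally show ?thesis using torsion_free_nat[of "x \<star> (y \<star> z)" 2] by simp
qed

text \<open>
  Multiplied by \<open>1 + a\<close>, the law reads \<open>(1 + a) (1 + a + b + c + b c) = (1 + a + b) (1 + a + c)\<close> in ring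
  notation, and the two sides differ by \<open>a b c\<close> only.
\<close>
lemma opposite_compat:
  assumes [simp]: "a \<in> carrier A" "b \<in> carrier A" "c \<in> carrier A"
  shows "a \<otimes> (b \<otimes>\<^bsub>M\<^esub> c) = (a \<otimes> b) \<otimes>\<^bsub>M\<^esub> inv\<^bsub>M\<^esub> a \<otimes>\<^bsub>M\<^esub> (a \<otimes> c)"
proof -
  have inv [simp]: "inv\<^bsub>M\<^esub> a \<in> carrier A" using mul.inv_closed[of a] by simp
  have "a \<otimes>\<^bsub>M\<^esub> (a \<otimes> (b \<otimes>\<^bsub>M\<^esub> c)) = (a \<otimes> b) \<otimes>\<^bsub>M\<^esub> (a \<otimes> c)"
    by (simp add: circ_eq star_add add_star triple_product_zero star_commute[of b a] add.m_ac)
  also have "\<dots> = a \<otimes>\<^bsub>M\<^esub> ((a \<otimes> b) \<otimes>\<^bsub>M\<^esub> inv\<^bsub>M\<^esub> a \<otimes>\<^bsub>M\<^esub> (a \<otimes> c))"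
  proof -
    have "a \<otimes>\<^bsub>M\<^esub> ((a \<otimes> b) \<otimes>\<^bsub>M\<^esub> inv\<^bsub>M\<^esub> a \<otimes>\<^bsub>M\<^esub> (a \<otimes> c))
        = (a \<otimes>\<^bsub>M\<^esub> inv\<^bsub>M\<^esub> a) \<otimes>\<^bsub>M\<^esub> ((a \<otimes> b) \<otimes>\<^bsub>M\<^esub> (a \<otimes> c))"
      by (simp only: mul.m_ac carrier_eq M_closed add.m_closed inv assms)
    also have "\<dots> = (a \<otimes> b) \<otimes>\<^bsub>M\<^esub> (a \<otimes> c)" using mul.r_inv[of a] mul.l_one by simp
    finally show ?thesis by simp
  qed
  finally show ?thesis by (rule mul.l_cancel) simp_all
qed

end

theorem corollary4p4:
  fixes A M :: "'a monoid"
  assumes "brace A M"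
    and "M \<cong> integer_group \<times>\<times> integer_group"
  shows "bi_skew_brace A M"
proof -
  have "comm_group A" "group A" "group M" and carrier: "carrier M = carrier A"
    and compat: "\<And>a b c. \<lbrakk>a \<in> carrier A; b \<in> carrier A; c \<in> carrier A\<rbrakk> \<Longrightarrow>
      a \<otimes>\<^bsub>M\<^esub> (b \<otimes>\<^bsub>A\<^esub> c) = (a \<otimes>\<^bsub>M\<^esub> b) \<otimes>\<^bsub>A\<^esub> inv\<^bsub>A\<^esub> a \<otimes>\<^bsub>A\<^esub> (a \<otimes>\<^bsub>M\<^esub> c)"
    using assms(1) by (auto simp: brace_def skew_brace_def)
  obtain h where h: "h \<in> iso M (integer_group \<times>\<times> integer_group)"
    using assms(2) by (auto simp: is_iso_def)
  then have inj: "inj_on h (carrier M)"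
    and mult: "h (x \<otimes>\<^bsub>M\<^esub> y) = (fst (h x) + fst (h y), snd (h x) + snd (h y))"
      if "x \<in> carrier M" "y \<in> carrier M" for x y
    using that by (auto simp: iso_def bij_betw_def hom_def DirProd_def split: prod.splits)
  have "x \<otimes>\<^bsub>M\<^esub> y = y \<otimes>\<^bsub>M\<^esub> x" if "x \<in> carrier M" "y \<in> carrier M" for x y
    using that \<open>group M\<close>
    by (intro inj_onD[OF inj]) (simp_all add: mult add.commute group.is_monoid monoid.m_closed)
  then have "comm_group M" using \<open>group M\<close> by (intro group.group_comm_groupI)
  interpret A: comm_group A by fact
  interpret M: comm_group M by fact
  interpret rank_two_radical_brace A M "\<lambda>x. fst (h x)" "\<lambda>x. snd (h x)"
  proof unfold_locales
    show "carrier M = carrier A" by (rule carrier)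
  next
    fix a b c assume "a \<in> carrier A" "b \<in> carrier A" "c \<in> carrier A"
    then show "a \<otimes>\<^bsub>M\<^esub> (b \<otimes>\<^bsub>A\<^esub> c) = (a \<otimes>\<^bsub>M\<^esub> b) \<otimes>\<^bsub>A\<^esub> inv\<^bsub>A\<^esub> a \<otimes>\<^bsub>A\<^esub> (a \<otimes>\<^bsub>M\<^esub> c)"
      by (rule compat)
  next
    fix x y assume xy: "x \<in> carrier A" "y \<in> carrier A"
    show "fst (h (x \<otimes>\<^bsub>M\<^esub> y)) = fst (h x) + fst (h y)" using xy by (simp add: mult carrier)
    show "snd (h (x \<otimes>\<^bsub>M\<^esub> y)) = snd (h x) + snd (h y)" using xy by (simp add: mult carrier)
    assume "fst (h x) = fst (h y)" "snd (h x) = snd (h y)"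
    then show "x = y" using xy by (intro inj_onD[OF inj]) (simp_all add: prod_eq_iff carrier)
  qed
  have "skew_brace M A"
    using \<open>group A\<close> \<open>group M\<close> carrier opposite_compat by (simp add: skew_brace_def)
  then show ?thesis using assms(1) by (simp add: bi_skew_brace_def brace_def)
qed

end
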